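(* Let $X=X_T$ be the binary tree space and consider the subset $\Sigma$ of $B_X$ given by $$\Sigma:=\{x\in B_X\colon \forall s\in T,\ x(s)\in\{-1,0,1\}\}.$$ Then $\Sigma$ is an SCD set, but $(\Sigma,w)$ has no countable $\pi$-base.
   Context: Binary tree space: $T=\{\emptyset\}\cup\bigcup_{n\in\mathbb{N}}\{0,1\}^n$ is the infinite binary tree of finite $0$-$1$ sequences, ordered by $s\preceq t$ iff $s$ is an initial segment of $t$. A chain is a non-empty (totally, hence well) ordered subset of $T$; $\mathcal{A}$ is the collection of all chains. $X=X_T$ is the real Banach space obtained by completing the space $c_{00}(T)$ of finitely supported real functions on $T$ for the norm $\|x\|=\sup_{A\in\mathcal{A}}\sum_{t\in A}|x(t)|$. The family $(e_t)_{t\in T}$ of unit vectors is a 1-unconditional basis of $X$, and elements of $X$ are identified with their coordinate functions $x=(x(t))_{t\in T}$. $B_X$ is the closed unit ball. SCD (for not necessarily convex sets): Let $A$ be a bounded non-empty subset of $X$. A slice of $A$ is a set $\{x\in A\colon f(x)>\sup f(A)-\delta\}$ with $f\in X^*$, $\delta>0$. A collection $\{A_i\}_{i\in I}$ of non-empty subsets of $A$ is determining for $A$ if $A\subseteq\overline{\mathrm{conv}}\{x_i\colon i\in I\}$ for every $(x_i)_{i\in I}\in\prod_{i\in I}A_i$. $A$ is an SCD set (slicely countably determined) if it admits a countable determining collection of slices. $(\Sigma,w)$ denotes $\Sigma$ with the relative weak topology of $X$. A $\pi$-base of a topological space is a collection $\{V_i\}_{i\in I}$ of non-empty open subsets such that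 every non-empty open subset contains one of the sets $V_i$. *)

theory Defs
  imports "HOL-Analysis.Analysis" "HOL-Library.Sublist"
begin

section \<open>The binary tree space\<close>

text \<open>The tree \<open>T\<close> is the type \<^typ>\<open>bool list\<close>, ordered by \<^const>\<open>prefix\<close>; the empty list is the root.\<close>

definition tree_chains :: "bool list set set" where
  "tree_chains = {A. A \<noteq> {} \<and> Complete_Partial_Order.chain prefix A}"

text \<open>\<open>tree_norm\<close> is a supremum of reals, and hence only meaningful for \<open>x\<close> such that
  \<open>chain_bound x c\<close> holds for some \<open>c\<close>; see \<open>chain_bound_iff_norm\<close> below.\<close>

definition tree_norm :: "(bool list \<Rightarrow> real) \<Rightarrow> real" where
  "tree_norm x = (SUP A\<in>tree_chains. \<Sum>\<^sub>\<infinity>t\<in>A. \<bar>x t\<bar>)"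

definition chain_bound :: "(bool list \<Rightarrow> real) \<Rightarrow> real \<Rightarrow> bool" where
  "chain_bound x c \<longleftrightarrow>
     (\<forall>A\<in>tree_chains. (\<lambda>t. \<bar>x t\<bar>) summable_on A \<and> (\<Sum>\<^sub>\<infinity>t\<in>A. \<bar>x t\<bar>) \<le> c)"

lemma tree_chains_subset: "A \<in> tree_chains \<Longrightarrow> F \<subseteq> A \<Longrightarrow> F \<noteq> {} \<Longrightarrow> F \<in> tree_chains"
  by (auto simp: tree_chains_def Complete_Partial_Order.chain_def)

lemma singleton_in_tree_chains [simp]: "{t} \<in> tree_chains"
  by (auto simp: tree_chains_def Complete_Partial_Order.chain_def)

lemma tree_chains_nonempty [simp]: "tree_chains \<noteq> {}"
  using singleton_in_tree_chains by blast

lemma chain_bound_nonneg: "chain_bound x c \<Longrightarrow> 0 \<le> c"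
  unfolding chain_bound_def using singleton_in_tree_chains[of "[]"] infsum_nonneg
  by (metis (no_types, lifting) abs_ge_zero order_trans)

lemma chain_bound_iff:
  "chain_bound x c \<longleftrightarrow> (\<forall>F\<in>tree_chains. finite F \<longrightarrow> (\<Sum>t\<in>F. \<bar>x t\<bar>) \<le> c)"
proof
  assume "chain_bound x c"
  then show "\<forall>F\<in>tree_chains. finite F \<longrightarrow> (\<Sum>t\<in>F. \<bar>x t\<bar>) \<le> c"
    unfolding chain_bound_def by (metis (no_types, lifting) infsum_finite)
next
  assume *: "\<forall>F\<in>tree_chains. finite F \<longrightarrow> (\<Sum>t\<in>F. \<bar>x t\<bar>) \<le> c"
  have "\<bar>x []\<bar> \<le> c"
    using *[rule_format, of "{[]}"] by simp
  then have c: "0 \<le> c" by linarith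
  show "chain_bound x c"
    unfolding chain_bound_def
  proof
    fix A assume A: "A \<in> tree_chains"
    have le: "(\<Sum>t\<in>F. \<bar>x t\<bar>) \<le> c" if "finite F" "F \<subseteq> A" for F
      using that c * tree_chains_subset[OF A, of F] by (cases "F = {}") auto
    have s: "(\<lambda>t. \<bar>x t\<bar>) summable_on A"
      by (rule nonneg_bdd_above_summable_on) (use le in \<open>auto intro!: bdd_aboveI[of _ c]\<close>)
    then show "(\<lambda>t. \<bar>x t\<bar>) summable_on A \<and> (\<Sum>\<^sub>\<infinity>t\<in>A. \<bar>x t\<bar>) \<le> c"
      using infsum_le_finite_sums[OF s le] by blast
  qed
qed

lemma chain_bound_add:
  assumes "chain_bound x a" "chain_bound y b"
  shows "chain_bound (\<lambda>t. x t + y t) (a + b)"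
  unfolding chain_bound_iff
proof (intro ballI impI)
  fix F assume F: "F \<in> tree_chains" "finite F"
  have "(\<Sum>t\<in>F. \<bar>x t + y t\<bar>) \<le> (\<Sum>t\<in>F. \<bar>x t\<bar>) + (\<Sum>t\<in>F. \<bar>y t\<bar>)"
    by (subst sum.distrib[symmetric]) (intro sum_mono abs_triangle_ineq)
  also have "\<dots> \<le> a + b"
    using assms F unfolding chain_bound_iff by (intro add_mono) auto
  finally show "(\<Sum>t\<in>F. \<bar>x t + y t\<bar>) \<le> a + b" .
qed

lemma chain_bound_scale:
  assumes "chain_bound x a"
  shows "chain_bound (\<lambda>t. r * x t) (\<bar>r\<bar> * a)"
  using assms unfolding chain_bound_iff
  by (auto simp: abs_mult sum_distrib_left[symmetric] intro!: mult_left_mono)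

lemma chain_bound_mono: "chain_bound x a \<Longrightarrow> a \<le> b \<Longrightarrow> chain_bound x b"
  unfolding chain_bound_def by (meson order_trans)

lemma chain_bound_minus_commute:
  "chain_bound (\<lambda>t. x t - y t) c \<longleftrightarrow> chain_bound (\<lambda>t. y t - x t) c"
  unfolding chain_bound_def by (simp add: abs_minus_commute)

lemma chain_bound_finite_support:
  assumes "finite {t. y t \<noteq> 0}"
  shows "\<exists>c. chain_bound y c"
proof
  show "chain_bound y (\<Sum>t | y t \<noteq> 0. \<bar>y t\<bar>)"
    unfolding chain_bound_iff
  proof (intro ballI impI)
    fix F assume "finite (F :: bool list set)"
    then have "(\<Sum>t\<in>F. \<bar>y t\<bar>) = (\<Sum>t\<in>F \<inter> {t. y t \<noteq> 0}. \<bar>y t\<bar>)"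
      by (intro sum.mono_neutral_right) auto
    also have "\<dots> \<le> (\<Sum>t | y t \<noteq> 0. \<bar>y t\<bar>)"
      using assms by (intro sum_mono2) auto
    finally show "(\<Sum>t\<in>F. \<bar>y t\<bar>) \<le> (\<Sum>t | y t \<noteq> 0. \<bar>y t\<bar>)" .
  qed
qed

lemma tree_norm_le: "chain_bound x c \<Longrightarrow> tree_norm x \<le> c"
  unfolding tree_norm_def chain_bound_def by (intro cSUP_least) auto

lemma chain_bound_tree_norm:
  assumes "chain_bound x c"
  shows "chain_bound x (tree_norm x)"
  unfolding chain_bound_def
proof
  fix A assume "A \<in> tree_chains"
  moreover have "bdd_above ((\<lambda>A. \<Sum>\<^sub>\<infinity>t\<in>A. \<bar>x t\<bar>) ` tree_chains)"
    using assms unfolding chain_bound_def by (auto intro!: bdd_aboveI[of _ c])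
  ultimately show "(\<lambda>t. \<bar>x t\<bar>) summable_on A \<and> (\<Sum>\<^sub>\<infinity>t\<in>A. \<bar>x t\<bar>) \<le> tree_norm x"
    using assms unfolding chain_bound_def tree_norm_def by (auto intro!: cSUP_upper)
qed

text \<open>The completion of \<open>c\<^sub>0\<^sub>0(T)\<close>, realised as a space of functions on \<open>T\<close>: those which
  are limits, with respect to the supremum over chains, of finitely supported functions. The
  \<open>banach\<close> instance below and the lemmas \<open>norm_eq\<close>, \<open>coord_summable_on\<close>,
  \<open>norm_bdd_above\<close>, \<open>finite_support_ex\<close> and \<open>finite_support_dense\<close> show that this is the completion. The map \<open>coord\<close> sends an
  element to its coordinate function.\<close>

typedef tree_space =
  "{x :: bool list \<Rightarrow> real. \<forall>\<epsilon>>0. \<exists>y. finite {t. y t \<noteq> 0} \<and> chain_bound (\<lambda>t. x t - y t) \<epsilon>}"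
  morphisms coord Abs_tree_space
proof -
  have "chain_bound (\<lambda>t. 0 - 0) \<epsilon>" if "\<epsilon> > 0" for \<epsilon>
    using that by (simp add: chain_bound_iff)
  then show ?thesis
    by (intro exI[of _ "\<lambda>_. 0"]) (auto intro!: exI[of _ "\<lambda>_. 0"])
qed

lemma coord_approx:
  "\<epsilon> > 0 \<Longrightarrow> \<exists>y. finite {t. y t \<noteq> 0} \<and> chain_bound (\<lambda>t. coord x t - y t) \<epsilon>"
  using coord[of x] by blast

lemma coord_chain_bound: "\<exists>c. chain_bound (coord x) c"
proof -
  obtain y where y: "finite {t. y t \<noteq> 0}" "chain_bound (\<lambda>t. coord x t - y t) 1"
    using coord_approx[of 1 x] by auto
  obtain c where "chain_bound y c"
    using chain_bound_finite_support[OF y(1)] by blast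
  from chain_bound_add[OF y(2) this] show ?thesis by auto
qed

lemma tree_space_add_closed:
  assumes x: "x \<in> {x. \<forall>\<epsilon>>0. \<exists>y. finite {t. y t \<noteq> 0} \<and> chain_bound (\<lambda>t. x t - y t) \<epsilon>}"
    and x': "x' \<in> {x. \<forall>\<epsilon>>0. \<exists>y. finite {t. y t \<noteq> 0} \<and> chain_bound (\<lambda>t. x t - y t) \<epsilon>}"
  shows "(\<lambda>t. x t + x' t) \<in>
    {x. \<forall>\<epsilon>>0. \<exists>y. finite {t. y t \<noteq> 0} \<and> chain_bound (\<lambda>t. x t - y t) \<epsilon>}"
proof (clarify)
  fix \<epsilon> :: real assume "\<epsilon> > 0"
  then have e: "\<epsilon>/2 > 0" by simp
  obtain y where y: "finite {t. y t \<noteq> 0}" "chain_bound (\<lambda>t. x t - y t) (\<epsilon>/2)"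
    using x e by blast
  obtain y' where y': "finite {t. y' t \<noteq> 0}" "chain_bound (\<lambda>t. x' t - y' t) (\<epsilon>/2)"
    using x' e by blast
  have "finite {t. y t + y' t \<noteq> 0}"
    by (rule finite_subset[OF _ finite_UnI[OF y(1) y'(1)]]) auto
  moreover have "chain_bound (\<lambda>t. (x t + x' t) - (y t + y' t)) \<epsilon>"
    using chain_bound_add[OF y(2) y'(2)] by (simp add: algebra_simps)
  ultimately show "\<exists>y. finite {t. y t \<noteq> 0} \<and> chain_bound (\<lambda>t. x t + x' t - y t) \<epsilon>"
    by (intro exI[of _ "\<lambda>t. y t + y' t"]) simp
qed

lemma tree_space_scale_closed:
  assumes x: "x \<in> {x. \<forall>\<epsilon>>0. \<exists>y. finite {t. y t \<noteq> 0} \<and> chain_bound (\<lambda>t. x t - y t) \<epsilon>}"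
  shows "(\<lambda>t. r * x t) \<in>
    {x. \<forall>\<epsilon>>0. \<exists>y. finite {t. y t \<noteq> 0} \<and> chain_bound (\<lambda>t. x t - y t) \<epsilon>}"
proof (clarify)
  fix \<epsilon> :: real assume e: "\<epsilon> > 0"
  then have "\<epsilon> / (\<bar>r\<bar> + 1) > 0" by (simp add: divide_pos_pos)
  then obtain y where y: "finite {t. y t \<noteq> 0}" "chain_bound (\<lambda>t. x t - y t) (\<epsilon> / (\<bar>r\<bar> + 1))"
    using x by blast
  have "\<bar>r\<bar> * (\<epsilon> / (\<bar>r\<bar> + 1)) \<le> \<epsilon>"
    using e by (simp add: field_simps)
  moreover have "chain_bound (\<lambda>t. r * x t - r * y t) (\<bar>r\<bar> * (\<epsilon> / (\<bar>r\<bar> + 1)))"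
    using chain_bound_scale[OF y(2), of r] by (simp add: right_diff_distrib)
  ultimately have "chain_bound (\<lambda>t. r * x t - r * y t) \<epsilon>"
    using chain_bound_mono by blast
  moreover have "finite {t. r * y t \<noteq> 0}"
    by (rule finite_subset[OF _ y(1)]) auto
  ultimately show "\<exists>y. finite {t. y t \<noteq> 0} \<and> chain_bound (\<lambda>t. r * x t - y t) \<epsilon>"
    by (intro exI[of _ "\<lambda>t. r * y t"]) simp
qed

lemma finite_support_in_tree_space:
  assumes "finite {t. y t \<noteq> (0 :: real)}"
  shows "y \<in> {x. \<forall>\<epsilon>>0. \<exists>y. finite {t. y t \<noteq> 0} \<and> chain_bound (\<lambda>t. x t - y t) \<epsilon>}"
  using assms by (auto intro!: exI[of _ y] simp: chain_bound_iff)

instantiation tree_space :: real_normed_vector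
begin

definition zero_tree_space :: tree_space where "0 = Abs_tree_space (\<lambda>t. 0)"
definition plus_tree_space :: "tree_space \<Rightarrow> tree_space \<Rightarrow> tree_space" where
  "x + y = Abs_tree_space (\<lambda>t. coord x t + coord y t)"
definition scaleR_tree_space :: "real \<Rightarrow> tree_space \<Rightarrow> tree_space" where
  "r *\<^sub>R x = Abs_tree_space (\<lambda>t. r * coord x t)"
definition uminus_tree_space :: "tree_space \<Rightarrow> tree_space" where
  "- x = (-1) *\<^sub>R (x :: tree_space)"
definition minus_tree_space :: "tree_space \<Rightarrow> tree_space \<Rightarrow> tree_space" where
  "x - y = x + (- y :: tree_space)"
definition norm_tree_space :: "tree_space \<Rightarrow> real" where
  "norm x = tree_norm (coord x)"
definition sgn_tree_space :: "tree_space \<Rightarrow> tree_space" where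
  "sgn x = inverse (norm x) *\<^sub>R (x :: tree_space)"
definition dist_tree_space :: "tree_space \<Rightarrow> tree_space \<Rightarrow> real" where
  "dist x y = norm (x - y :: tree_space)"
definition uniformity_tree_space :: "(tree_space \<times> tree_space) filter" where
  "uniformity_tree_space = (INF e\<in>{0<..}. principal {(x, y). dist x y < e})"
definition open_tree_space :: "tree_space set \<Rightarrow> bool" where
  "open_tree_space U = (\<forall>x\<in>U. \<forall>\<^sub>F (x', y) in uniformity. x' = x \<longrightarrow> y \<in> U)"

lemma coord_zero: "coord 0 t = 0"
  unfolding zero_tree_space_def
  by (subst Abs_tree_space_inverse[OF finite_support_in_tree_space]) auto

lemma coord_add: "coord (x + y) t = coord x t + coord y t"
  unfolding plus_tree_space_def
  by (subst Abs_tree_space_inverse[OF tree_space_add_closed[OF coord coord]]) (rule refl)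

lemma coord_scaleR: "coord (r *\<^sub>R x) t = r * coord x t"
  unfolding scaleR_tree_space_def
  by (subst Abs_tree_space_inverse[OF tree_space_scale_closed[OF coord]]) (rule refl)

lemma coord_uminus: "coord (- x) t = - coord x t"
  by (simp add: uminus_tree_space_def coord_scaleR)

lemma coord_diff: "coord (x - y) t = coord x t - coord y t"
  by (simp add: minus_tree_space_def coord_add coord_uminus)

lemma tree_space_eqI: "(\<And>t. coord x t = coord y t) \<Longrightarrow> x = y"
  by (metis coord_inject ext)

lemma chain_bound_iff_norm: "chain_bound (coord x) c \<longleftrightarrow> norm x \<le> c"
  unfolding norm_tree_space_def
  using tree_norm_le chain_bound_tree_norm chain_bound_mono coord_chain_bound by metis

instance
proof
  fix x y z :: tree_space and a b r :: real
  show "x + y + z = x + (y + z)" "x + y = y + x" "0 + x = x" "- x + x = 0" "x - y = x + - y"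
    "a *\<^sub>R (x + y) = a *\<^sub>R x + a *\<^sub>R y" "(a + b) *\<^sub>R x = a *\<^sub>R x + b *\<^sub>R x"
    "a *\<^sub>R b *\<^sub>R x = (a * b) *\<^sub>R x" "1 *\<^sub>R x = x"
    by (auto intro!: tree_space_eqI
        simp: coord_add coord_zero coord_uminus coord_diff coord_scaleR algebra_simps)
  show "dist x y = norm (x - y)" "sgn x = inverse (norm x) *\<^sub>R x"
    by (simp_all add: dist_tree_space_def sgn_tree_space_def)
  show "(uniformity :: (tree_space \<times> tree_space) filter) =
      (INF e\<in>{0<..}. principal {(x, y). dist x y < e})"
    by (rule uniformity_tree_space_def)
  show "open U \<longleftrightarrow> (\<forall>x\<in>U. \<forall>\<^sub>F (x', y) in uniformity. x' = x \<longrightarrow> y \<in> U)"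
    for U :: "tree_space set"
    by (rule open_tree_space_def)
  have coord0: "coord x t = 0" if "norm x = 0" for t
  proof -
    have "chain_bound (coord x) 0" using that by (simp add: chain_bound_iff_norm)
    then have "(\<Sum>s\<in>{t}. \<bar>coord x s\<bar>) \<le> 0"
      unfolding chain_bound_iff using singleton_in_tree_chains by blast
    then show ?thesis by simp
  qed
  have n0: "norm (x :: tree_space) \<ge> 0" for x
    using chain_bound_nonneg chain_bound_iff_norm by blast
  have "norm (0 :: tree_space) \<le> 0"
    by (subst chain_bound_iff_norm[symmetric]) (simp add: chain_bound_iff coord_zero)
  then have "norm (0 :: tree_space) = 0" using n0[of 0] by linarith
  then show "norm x = 0 \<longleftrightarrow> x = 0"
    using coord0 by (auto intro!: tree_space_eqI simp: coord_zero)
  show "norm (x + y) \<le> norm x + norm y"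
  proof -
    have "chain_bound (\<lambda>t. coord x t + coord y t) (norm x + norm y)"
      by (intro chain_bound_add) (simp_all add: chain_bound_iff_norm)
    moreover have "coord (x + y) = (\<lambda>t. coord x t + coord y t)" by (auto simp: coord_add)
    ultimately show ?thesis by (metis chain_bound_iff_norm)
  qed
  have sc: "norm (a *\<^sub>R x) \<le> \<bar>a\<bar> * norm x" for a and x :: tree_space
  proof -
    have "chain_bound (\<lambda>t. a * coord x t) (\<bar>a\<bar> * norm x)"
      by (intro chain_bound_scale) (simp add: chain_bound_iff_norm)
    moreover have "coord (a *\<^sub>R x) = (\<lambda>t. a * coord x t)" by (auto simp: coord_scaleR)
    ultimately show ?thesis by (metis chain_bound_iff_norm)
  qed
  show "norm (a *\<^sub>R x) = \<bar>a\<bar> * norm x"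
  proof (cases "a = 0")
    case True
    then show ?thesis using sc[of a x] n0[of "a *\<^sub>R x"] by simp
  next
    case False
    have "inverse a *\<^sub>R a *\<^sub>R x = x"
      using False by (auto intro!: tree_space_eqI simp: coord_scaleR)
    then have "norm x \<le> \<bar>inverse a\<bar> * norm (a *\<^sub>R x)"
      using sc[of "inverse a" "a *\<^sub>R x"] by simp
    then have "\<bar>a\<bar> * norm x \<le> norm (a *\<^sub>R x)"
      using False by (simp add: field_simps)
    then show ?thesis using sc[of a x] by linarith
  qed
qed

end

lemma norm_eq: "norm x = (SUP A\<in>tree_chains. \<Sum>\<^sub>\<infinity>t\<in>A. \<bar>coord x t\<bar>)"
  by (simp add: norm_tree_space_def tree_norm_def)

lemma coord_summable_on: "A \<in> tree_chains \<Longrightarrow> (\<lambda>t. \<bar>coord x t\<bar>) summable_on A"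
  using coord_chain_bound[of x] unfolding chain_bound_def by blast

lemma norm_bdd_above: "bdd_above ((\<lambda>A. \<Sum>\<^sub>\<infinity>t\<in>A. \<bar>coord x t\<bar>) ` tree_chains)"
  using coord_chain_bound[of x] unfolding chain_bound_def bdd_above_def by blast

lemma coord_diff_fun: "coord (x - y) = (\<lambda>t. coord x t - coord y t)"
  by (auto simp: coord_diff)

lemma abs_coord_le_norm: "\<bar>coord x t\<bar> \<le> norm x"
proof -
  have "(\<Sum>s\<in>{t}. \<bar>coord x s\<bar>) \<le> norm x"
    using chain_bound_iff_norm[of x "norm x"] singleton_in_tree_chains unfolding chain_bound_iff
    by blast
  then show ?thesis by simp
qed

instance tree_space :: banach
proof
  fix X :: "nat \<Rightarrow> tree_space" assume X: "Cauchy X"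
  have "Cauchy (\<lambda>n. coord (X n) t)" for t
    unfolding Cauchy_def
  proof (intro allI impI)
    fix e :: real assume "e > 0"
    then obtain M where M: "\<forall>m\<ge>M. \<forall>n\<ge>M. dist (X m) (X n) < e"
      using X unfolding Cauchy_def by blast
    have "dist (coord (X m) t) (coord (X n) t) \<le> dist (X m) (X n)" for m n
      using abs_coord_le_norm[of "X m - X n" t] by (simp add: dist_norm coord_diff)
    then show "\<exists>M. \<forall>m\<ge>M. \<forall>n\<ge>M. dist (coord (X m) t) (coord (X n) t) < e"
      using M by (meson order_le_less_trans)
  qed
  then have "\<exists>l. (\<lambda>n. coord (X n) t) \<longlonglongrightarrow> l" for t
    by (simp add: Cauchy_convergent_iff convergent_def)
  then obtain l where l: "\<And>t. (\<lambda>n. coord (X n) t) \<longlonglongrightarrow> l t"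
    by metis
  have lim: "\<exists>N. \<forall>n\<ge>N. chain_bound (\<lambda>t. l t - coord (X n) t) e" if epos: "e > 0" for e
  proof -
    obtain N where N: "\<forall>m\<ge>N. \<forall>n\<ge>N. norm (X m - X n) < e"
      using X epos unfolding Cauchy_def dist_norm by blast
    have "chain_bound (\<lambda>t. l t - coord (X n) t) e" if n: "n \<ge> N" for n
      unfolding chain_bound_iff
    proof (intro ballI impI)
      fix F assume F: "F \<in> tree_chains" "finite F"
      have "(\<lambda>m. \<Sum>t\<in>F. \<bar>coord (X m) t - coord (X n) t\<bar>) \<longlonglongrightarrow> (\<Sum>t\<in>F. \<bar>l t - coord (X n) t\<bar>)"
        by (intro tendsto_intros l)
      moreover have "(\<Sum>t\<in>F. \<bar>coord (X m) t - coord (X n) t\<bar>) \<le> e" if m: "m \<ge> N" for m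
      proof -
        have "chain_bound (coord (X m - X n)) e"
          using N m n by (simp add: chain_bound_iff_norm less_imp_le)
        then show ?thesis using F unfolding chain_bound_iff by (simp add: coord_diff)
      qed
      ultimately show "(\<Sum>t\<in>F. \<bar>l t - coord (X n) t\<bar>) \<le> e"
        by (intro LIMSEQ_le_const2) auto
    qed
    then show ?thesis by blast
  qed
  have "l \<in> {x. \<forall>\<epsilon>>0. \<exists>y. finite {t. y t \<noteq> 0} \<and> chain_bound (\<lambda>t. x t - y t) \<epsilon>}"
  proof clarify
    fix e :: real assume "e > 0"
    then have e: "e/2 > 0" by simp
    obtain n where n: "chain_bound (\<lambda>t. l t - coord (X n) t) (e/2)"
      using lim[OF e] by blast
    obtain y where y: "finite {t. y t \<noteq> 0}" "chain_bound (\<lambda>t. coord (X n) t - y t) (e/2)"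
      using coord_approx[OF e] by blast
    have "chain_bound (\<lambda>t. l t - y t) e"
      using chain_bound_add[OF n y(2)] by simp
    then show "\<exists>y. finite {t. y t \<noteq> 0} \<and> chain_bound (\<lambda>t. l t - y t) e"
      using y(1) by blast
  qed
  then have cl: "coord (Abs_tree_space l) = l"
    by (rule Abs_tree_space_inverse)
  have "X \<longlonglongrightarrow> Abs_tree_space l"
    unfolding LIMSEQ_def
  proof (intro allI impI)
    fix e :: real assume e: "e > 0"
    then obtain N where "\<forall>n\<ge>N. chain_bound (\<lambda>t. l t - coord (X n) t) (e/2)"
      using lim[of "e/2"] by auto
    then have "\<forall>n\<ge>N. norm (Abs_tree_space l - X n) \<le> e/2"
      unfolding chain_bound_iff_norm[symmetric] coord_diff_fun cl by blast
    then have "\<forall>n\<ge>N. dist (X n) (Abs_tree_space l) < e"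
      using e by (fastforce simp: dist_norm norm_minus_commute)
    then show "\<exists>N. \<forall>n\<ge>N. dist (X n) (Abs_tree_space l) < e" by blast
  qed
  then show "convergent X" unfolding convergent_def by blast
qed

lemma finite_support_ex:
  assumes "finite {t. y t \<noteq> 0}"
  shows "\<exists>!x. coord x = y"
  using Abs_tree_space_inverse[OF finite_support_in_tree_space[OF assms]] coord_inject by metis

lemma finite_support_dense: "closure {x. finite {t. coord x t \<noteq> 0}} = UNIV"
proof -
  have "x \<in> closure {x. finite {t. coord x t \<noteq> 0}}" for x
    unfolding closure_approachable
  proof (intro allI impI)
    fix e :: real assume e: "e > 0"
    then obtain y where y: "finite {t. y t \<noteq> 0}" "chain_bound (\<lambda>t. coord x t - y t) (e/2)"
      using coord_approx[of "e/2" x] by auto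
    then obtain z where z: "coord z = y" using finite_support_ex by blast
    have "norm (x - z) \<le> e/2"
      using y(2) unfolding chain_bound_iff_norm[symmetric] coord_diff_fun z .
    then have "dist z x < e" using e by (simp add: dist_norm norm_minus_commute)
    then show "\<exists>z\<in>{x. finite {t. coord x t \<noteq> 0}}. dist z x < e" using y z by blast
  qed
  then show ?thesis by blast
qed

section \<open>Slicely countably determined sets\<close>

definition slice_of :: "'a::real_normed_vector set \<Rightarrow> 'a set \<Rightarrow> bool" where
  "slice_of A S \<longleftrightarrow> (\<exists>(f :: 'a \<Rightarrow> real) \<delta>. bounded_linear f \<and> \<delta> > 0 \<and>
     S = {x \<in> A. f x > Sup (f ` A) - \<delta>})"

definition determining_for ::
    "'i set \<Rightarrow> ('i \<Rightarrow> 'a::real_normed_vector set) \<Rightarrow> 'a set \<Rightarrow> bool" where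
  "determining_for I V A \<longleftrightarrow> (\<forall>i\<in>I. V i \<noteq> {} \<and> V i \<subseteq> A) \<and>
     (\<forall>x. (\<forall>i\<in>I. x i \<in> V i) \<longrightarrow> A \<subseteq> closure (convex hull (x ` I)))"

text \<open>A countable family, possibly finite, is a family indexed by a set of naturals.\<close>

definition SCD_set :: "'a::real_normed_vector set \<Rightarrow> bool" where
  "SCD_set A \<longleftrightarrow> bounded A \<and> A \<noteq> {} \<and>
     (\<exists>(I :: nat set) S. (\<forall>i\<in>I. slice_of A (S i)) \<and> determining_for I S A)"

section \<open>The weak topology and \<open>\<pi>\<close>-bases\<close>

definition weak_topology :: "'a::real_normed_vector topology" where
  "weak_topology =
     topology_generated_by {f -` U | (f :: 'a \<Rightarrow> real) U. bounded_linear f \<and> open U}"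

definition pi_base :: "'a topology \<Rightarrow> 'i set \<Rightarrow> ('i \<Rightarrow> 'a set) \<Rightarrow> bool" where
  "pi_base X I V \<longleftrightarrow> (\<forall>i\<in>I. openin X (V i) \<and> V i \<noteq> {}) \<and>
     (\<forall>U. openin X U \<and> U \<noteq> {} \<longrightarrow> (\<exists>i\<in>I. V i \<subseteq> U))"

definition has_countable_pi_base :: "'a topology \<Rightarrow> bool" where
  "has_countable_pi_base X \<longleftrightarrow> (\<exists>(I :: nat set) V. pi_base X I V)"

section \<open>The set \<open>\<Sigma>\<close>\<close>

definition Sigma_set :: "tree_space set" where
  "Sigma_set = {x \<in> cball 0 1. \<forall>s. coord x s \<in> {-1, 0, 1}}"

end

theory Submission
  imports Defs
begin

text \<open>An element of \<open>X\<close> with coordinates in \<open>{-1, 0, 1}\<close> has finite support, since it is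
  within \<open>1/2\<close> of a finitely supported function, and its norm is at most \<open>1\<close> exactly when no
  chain meets its support twice. So \<open>\<Sigma>\<close> is the countable set of signed finite antichains of
  the tree (\<open>Sigma_set_iff\<close>).

  \<^emph>\<open>SCD.\<close> If the support \<open>F\<close> of \<open>x \<in> \<Sigma>\<close> is a maximal antichain, then \<open>{x}\<close> is itself a
  slice: the functional \<open>y \<mapsto> \<Sum>t\<in>F. x(t) y(t)\<close> takes integer values on \<open>\<Sigma>\<close>, and its maximum
  \<open>|F|\<close> forces \<open>y = x\<close> on \<open>F\<close>, which by maximality leaves no room for other coordinates
  (\<open>maximal_point_slice\<close>). An arbitrary \<open>x \<in> \<Sigma>\<close> is the midpoint of \<open>x + g\<close> and \<open>x - g\<close>,
  where \<open>g\<close> is the indicator of a finite set that completes the support of \<open>x\<close> to a maximal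
  antichain (\<open>extend_to_maximal\<close>). Hence the countably many singleton slices determine
  \<open>\<Sigma>\<close>.

  \<^emph>\<open>No countable \<open>\<pi>\<close>-base.\<close> For a branch \<open>b\<close> let \<open>W\<^sub>b\<close> be the relatively weakly open set of
  those \<open>x \<in> \<Sigma>\<close> whose coordinate sum along \<open>b\<close> has absolute value below \<open>1/2\<close>; it contains
  \<open>0\<close>. There are uncountably many branches, so it suffices that a non-empty relatively weakly
  open set \<open>V \<subseteq> \<Sigma>\<close> lies in \<open>W\<^sub>b\<close> for finitely many \<open>b\<close> only (\<open>finite_branches_with_open_subset\<close>). Choose
  \<open>x \<in> V\<close> and a basic neighbourhood of \<open>x\<close> given by finitely many functionals and \<open>\<epsilon> > 0\<close>.
  If \<open>V \<subseteq> W\<^sub>b\<close> and \<open>s\<close> is a node of \<open>b\<close> beyond the support of \<open>x\<close>, then \<open>x + e\<^sub>s\<close> is in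
  \<open>\<Sigma>\<close> but not in \<open>W\<^sub>b\<close>, so one of the functionals is at least \<open>\<epsilon>\<close> in absolute value at
  \<open>e\<^sub>s\<close>. Different branches give incomparable nodes \<open>s\<close> at a high level, and the unit vectors of
  an antichain span a copy of \<open>c\<^sub>0\<close>, so that \<open>\<Sum>\<^sub>s |f(e\<^sub>s)| \<le> \<parallel>f\<parallel>\<close>
  (\<open>sum_functional_antichain_le\<close>). This bounds the number of such branches.\<close>

section \<open>Signed antichains\<close>

lemma coord_Abs_finite_support:
  assumes "finite {t. y t \<noteq> (0 :: real)}"
  shows "coord (Abs_tree_space y) = y"
  by (rule Abs_tree_space_inverse[OF finite_support_in_tree_space[OF assms]])

lemma tree_chains_pair:
  assumes "\<not> s \<parallel> t"
  shows "{s, t} \<in> tree_chains"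
  using assms by (auto simp: tree_chains_def Complete_Partial_Order.chain_def parallel_def)

lemma parallel_of_same_length:
  assumes "length s = length t" "s \<noteq> t"
  shows "s \<parallel> t"
proof -
  have "\<not> prefix s t" "\<not> prefix t s"
    using assms by (auto elim!: prefixE)
  then show ?thesis by (rule parallelI)
qed

text \<open>Two comparable nodes form a chain, on which the norm bound \<open>1\<close> leaves room for one
  coordinate of absolute value \<open>1\<close>; conversely a chain meets an antichain at most once.\<close>

lemma Sigma_set_iff:
  "x \<in> Sigma_set \<longleftrightarrow> finite {t. coord x t \<noteq> 0} \<and> (\<forall>s. coord x s \<in> {-1, 0, 1}) \<and>
     (\<forall>s t. coord x s \<noteq> 0 \<longrightarrow> coord x t \<noteq> 0 \<longrightarrow> s \<noteq> t \<longrightarrow> s \<parallel> t)"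
  (is "_ \<longleftrightarrow> ?fin \<and> ?val \<and> ?anti")
proof (intro iffI conjI)
  assume x: "x \<in> Sigma_set"
  then have val: ?val and norm: "norm x \<le> 1" by (auto simp: Sigma_set_def)
  show ?val by (fact val)
  obtain y where y: "finite {t. y t \<noteq> 0}" "chain_bound (\<lambda>t. coord x t - y t) (1/2)"
    using coord_approx[of "1/2" x] by auto
  have "\<bar>coord x t - y t\<bar> \<le> 1/2" for t
    using y(2) singleton_in_tree_chains[of t] unfolding chain_bound_iff by fastforce
  then have "y t \<noteq> 0" if "coord x t \<noteq> 0" for t
    using that val[rule_format, of t] by (smt (verit) insert_iff empty_iff field_sum_of_halves)
  then have "{t. coord x t \<noteq> 0} \<subseteq> {t. y t \<noteq> 0}" by blast
  then show ?fin using y(1) by (rule finite_subset)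
  show ?anti
  proof (intro allI impI, rule ccontr)
    fix s t assume st: "coord x s \<noteq> 0" "coord x t \<noteq> 0" "s \<noteq> t" "\<not> s \<parallel> t"
    have "chain_bound (coord x) 1" using norm by (simp add: chain_bound_iff_norm)
    from this[unfolded chain_bound_iff, rule_format, OF tree_chains_pair[OF st(4)]]
    have "(\<Sum>u\<in>{s, t}. \<bar>coord x u\<bar>) \<le> 1" by simp
    then have "\<bar>coord x s\<bar> + \<bar>coord x t\<bar> \<le> 1"
      using st(3) by simp
    then show False
      using st(1,2) val[rule_format, of s] val[rule_format, of t] by auto
  qed
next
  assume "?fin \<and> ?val \<and> ?anti"
  then have val: ?val and anti: ?anti by blast+
  have "chain_bound (coord x) 1"
    unfolding chain_bound_iff
  proof (intro ballI impI)
    fix F assume F: "F \<in> tree_chains" "finite F"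
    let ?G = "{t \<in> F. coord x t \<noteq> 0}"
    have "s = t" if "s \<in> ?G" "t \<in> ?G" for s t
      using that anti F(1)
      by (auto simp: tree_chains_def Complete_Partial_Order.chain_def parallel_def)
    then have "card ?G \<le> 1"
      using F(2) by (auto simp: card_le_Suc0_iff_eq)
    have "(\<Sum>t\<in>F. \<bar>coord x t\<bar>) = (\<Sum>t\<in>?G. \<bar>coord x t\<bar>)"
      using F(2) by (intro sum.mono_neutral_right) auto
    also have "\<dots> \<le> of_nat (card ?G) * 1"
    proof (rule sum_bounded_above)
      show "\<bar>coord x t\<bar> \<le> 1" for t using val[rule_format, of t] by auto
    qed
    also have "\<dots> \<le> 1" using \<open>card ?G \<le> 1\<close> by simp
    finally show "(\<Sum>t\<in>F. \<bar>coord x t\<bar>) \<le> 1" .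
  qed
  then show "x \<in> Sigma_set"
    using val by (simp add: Sigma_set_def chain_bound_iff_norm)
qed

lemma Sigma_set_finite: "x \<in> Sigma_set \<Longrightarrow> finite {t. coord x t \<noteq> 0}"
  and Sigma_set_coord: "x \<in> Sigma_set \<Longrightarrow> coord x t \<in> {-1, 0, 1}"
  and Sigma_set_parallel:
    "x \<in> Sigma_set \<Longrightarrow> coord x s \<noteq> 0 \<Longrightarrow> coord x t \<noteq> 0 \<Longrightarrow> s \<noteq> t \<Longrightarrow> s \<parallel> t"
  unfolding Sigma_set_iff by blast+

lemma Sigma_setI:
  assumes "finite {t. coord x t \<noteq> 0}" "\<And>t. coord x t \<in> {-1, 0, 1}"
    and "\<And>s t. coord x s \<noteq> 0 \<Longrightarrow> coord x t \<noteq> 0 \<Longrightarrow> s \<noteq> t \<Longrightarrow> s \<parallel> t"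
  shows "x \<in> Sigma_set"
  using assms unfolding Sigma_set_iff by blast

text \<open>A point of \<open>\<Sigma>\<close> is determined by two finite sets of nodes: those where it is \<open>1\<close> and
  those where it is \<open>-1\<close>.\<close>

lemma countable_Sigma_set: "countable Sigma_set"
proof -
  let ?g = "\<lambda>x. ({t. coord x t = 1}, {t. coord x t = -1})"
  have "inj_on ?g Sigma_set"
  proof (rule inj_onI, rule tree_space_eqI)
    fix x y t assume xy: "x \<in> Sigma_set" "y \<in> Sigma_set" and eq: "?g x = ?g y"
    note Sigma_set_coord[OF xy(1), of t] Sigma_set_coord[OF xy(2), of t]
    moreover have "coord x t = 1 \<longleftrightarrow> coord y t = 1" "coord x t = -1 \<longleftrightarrow> coord y t = -1"
      using eq by (auto simp: set_eq_iff)
    ultimately show "coord x t = coord y t" by auto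
  qed
  moreover have "?g ` Sigma_set \<subseteq> Collect finite \<times> Collect finite"
    by (auto dest!: Sigma_set_finite intro: rev_finite_subset)
  then have "countable (?g ` Sigma_set)"
    by (rule countable_subset) (intro countable_SIGMA countable_Collect_finite)
  ultimately show ?thesis using countable_image_inj_on by blast
qed

lemma bounded_linear_coord: "bounded_linear (\<lambda>x. coord x t)"
  by (rule bounded_linear_intro[where K = 1]) (auto simp: coord_add coord_scaleR abs_coord_le_norm)

section \<open>Maximal antichains and slices\<close>

definition maximal_points :: "tree_space set" where
  "maximal_points = {x \<in> Sigma_set. \<forall>u. \<exists>t. coord x t \<noteq> 0 \<and> \<not> u \<parallel> t}"

text \<open>The slice is cut out by \<open>f y = (\<Sum>t\<in>F. x(t) y(t))\<close> with \<open>F\<close> the support of \<open>x\<close>. Each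
  term is in \<open>{-1, 0, 1}\<close>, so \<open>f y > |F| - 1\<close> forces all of them to be \<open>1\<close>: \<open>y\<close> agrees with
  \<open>x\<close> on \<open>F\<close>, and a node outside \<open>F\<close> is comparable to one in \<open>F\<close>, where \<open>y\<close> is already
  nonzero.\<close>

lemma maximal_point_slice:
  assumes "x \<in> maximal_points"
  shows "slice_of Sigma_set {x}"
proof -
  have x: "x \<in> Sigma_set" using assms by (simp add: maximal_points_def)
  define F where "F = {t. coord x t \<noteq> 0}"
  have F: "finite F" using Sigma_set_finite[OF x] by (simp add: F_def)
  define f where "f y = (\<Sum>t\<in>F. coord x t * coord y t)" for y
  have term_val: "coord x t * coord y t \<in> {-1, 0, 1}" if "y \<in> Sigma_set" for y t
    using Sigma_set_coord[OF x, of t] Sigma_set_coord[OF that, of t] by auto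
  have f_le: "f y \<le> card F" if "y \<in> Sigma_set" for y
  proof -
    have "f y \<le> of_nat (card F) * 1" unfolding f_def
    proof (rule sum_bounded_above)
      show "coord x t * coord y t \<le> 1" for t using term_val[OF that, of t] by auto
    qed
    then show ?thesis by simp
  qed
  have fx: "f x = card F"
  proof -
    have "coord x t * coord x t = 1" if "t \<in> F" for t
    proof -
      have "coord x t \<in> {-1, 0, 1}" by (rule Sigma_set_coord[OF x])
      then show ?thesis using that by (auto simp: F_def)
    qed
    then show ?thesis by (simp add: f_def)
  qed
  have sup: "Sup (f ` Sigma_set) = card F"
    by (rule cSup_eq_maximum) (use x fx f_le in \<open>auto intro!: image_eqI[of _ f x]\<close>)
  have unique: "y = x" if y: "y \<in> Sigma_set" "f y > real (card F) - 1" for y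
  proof (rule tree_space_eqI)
    have on_F: "coord y t = coord x t" if t: "t \<in> F" for t
    proof -
      have "(\<Sum>s\<in>F - {t}. coord x s * coord y s) \<le> of_nat (card (F - {t})) * 1"
      proof (rule sum_bounded_above)
        show "coord x s * coord y s \<le> 1" for s using term_val[OF y(1), of s] by auto
      qed
      moreover have "real (card (F - {t})) = real (card F) - 1"
        using card.remove[OF F t] by simp
      ultimately have "f y - coord x t * coord y t \<le> real (card F) - 1"
        by (simp add: f_def sum.remove[OF F t])
      then have "coord x t * coord y t = 1"
        using y(2) term_val[OF y(1), of t] by auto
      moreover have "coord x t \<in> {-1, 0, 1}" by (rule Sigma_set_coord[OF x])
      ultimately show ?thesis by auto
    qed
    fix u
    obtain t where t: "t \<in> F" "\<not> u \<parallel> t"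
      using assms by (auto simp: maximal_points_def F_def)
    show "coord y u = coord x u"
    proof (cases "u \<in> F")
      case False
      then have "u \<noteq> t" "coord x u = 0" "coord y t \<noteq> 0"
        using t on_F by (auto simp: F_def)
      then show ?thesis using Sigma_set_parallel[OF y(1), of u t] t(2) by auto
    qed (rule on_F)
  qed
  have "bounded_linear f"
    unfolding f_def
    by (intro bounded_linear_sum bounded_linear_const_mult bounded_linear_coord)
  moreover have "{x} = {y \<in> Sigma_set. f y > Sup (f ` Sigma_set) - 1}"
  proof (intro equalityI subsetI)
    fix y assume "y \<in> {y \<in> Sigma_set. f y > Sup (f ` Sigma_set) - 1}"
    then show "y \<in> {x}" using unique[of y] by (simp add: sup)
  qed (use x in \<open>simp add: sup fx\<close>)
  ultimately show ?thesis
    unfolding slice_of_def by (intro exI[of _ f] exI[of _ 1]) simp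
qed

text \<open>Let \<open>N\<close> be the largest length of a node in the support \<open>F\<close> of \<open>x\<close>. The
  nodes of level \<open>N\<close> without an initial segment in \<open>F\<close> complete \<open>F\<close> to a maximal
  antichain, with either sign on the added nodes.\<close>

lemma extend_to_maximal:
  assumes x: "x \<in> Sigma_set"
  obtains g where "x + g \<in> maximal_points" "x - g \<in> maximal_points"
proof -
  define F where "F = {t. coord x t \<noteq> 0}"
  have F: "finite F" using Sigma_set_finite[OF x] by (simp add: F_def)
  define N where "N = Max (insert 0 (length ` F))"
  have N: "length t \<le> N" if "t \<in> F" for t
    using F that by (auto simp: N_def)
  define G where "G = {s. length s = N \<and> (\<forall>t\<in>F. \<not> prefix t s)}"
  define y where "y s = (if s \<in> G then 1 else 0 :: real)" for s
  have "finite {s :: bool list. set s \<subseteq> UNIV \<and> length s = N}"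
    by (rule finite_lists_length_eq) simp
  then have G: "finite G" by (rule rev_finite_subset) (auto simp: G_def)
  then have fin_y: "finite {s. y s \<noteq> 0}" by (simp add: y_def)
  define g where "g = Abs_tree_space y"
  have cg: "coord g = y" unfolding g_def by (rule coord_Abs_finite_support[OF fin_y])
  have GG: "s \<parallel> t" if "s \<in> G" "t \<in> G" "s \<noteq> t" for s t
    using that by (intro parallel_of_same_length) (simp_all add: G_def)
  have FG: "s \<parallel> t" "t \<parallel> s" if "s \<in> F" "t \<in> G" for s t
  proof -
    have "\<not> prefix s t" using that by (auto simp: G_def)
    moreover have "\<not> prefix t s"
    proof
      assume "prefix t s"
      moreover have "length s \<le> length t" using N that by (auto simp: G_def)
      ultimately have "s = t" by (auto elim!: prefixE)
      with \<open>\<not> prefix s t\<close> show False by simp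
    qed
    ultimately show "s \<parallel> t" "t \<parallel> s" by (auto simp: parallel_def)
  qed
  have FF: "s \<parallel> t" if "s \<in> F" "t \<in> F" "s \<noteq> t" for s t
    using that Sigma_set_parallel[OF x] by (simp add: F_def)
  have disj: "F \<inter> G = {}" by (auto simp: G_def)
  have cover: "\<exists>t\<in>F \<union> G. \<not> u \<parallel> t" for u
  proof -
    \<comment> \<open>Cutting or padding \<open>u\<close> gives a comparable node \<open>v\<close> of level \<open>N\<close>: either \<open>v \<in> G\<close>,
      or \<open>v\<close> extends a node of \<open>F\<close>, which is then comparable to \<open>u\<close> as well.\<close>
    define v where "v = take N (u @ replicate N False)"
    have len: "length v = N" by (simp add: v_def)
    have pre: "prefix v (u @ replicate N False)" "prefix u (u @ replicate N False)"
      unfolding v_def by (rule take_is_prefix, simp)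
    show ?thesis
    proof (cases "v \<in> G")
      case True
      then show ?thesis using prefix_same_cases[OF pre] by (auto simp: parallel_def)
    next
      case False
      then obtain t where "t \<in> F" "prefix t v" using len by (auto simp: G_def)
      then show ?thesis
        using prefix_same_cases[OF prefix_order.trans[OF _ pre(1)] pre(2)]
        by (auto simp: parallel_def)
    qed
  qed
  have "z \<in> maximal_points" if z: "\<And>t. coord z t = coord x t + c * y t" and c: "c \<in> {-1, 1}"
    for z and c :: real
  proof -
    have xG: "coord x t = 0" if "t \<in> G" for t
      using disj that by (auto simp: F_def)
    have supp: "coord z t \<noteq> 0 \<longleftrightarrow> t \<in> F \<union> G" for t
      using xG[of t] c by (auto simp: z y_def F_def)
    have "z \<in> Sigma_set"
    proof (rule Sigma_setI)
      have "{t. coord z t \<noteq> 0} = F \<union> G" using supp by blast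
      then show "finite {t. coord z t \<noteq> 0}" using F G by simp
      show "coord z t \<in> {-1, 0, 1}" for t
        using xG[of t] c Sigma_set_coord[OF x, of t] by (auto simp: z y_def)
      show "s \<parallel> t" if "coord z s \<noteq> 0" "coord z t \<noteq> 0" "s \<noteq> t" for s t
        using that FF FG GG unfolding supp by blast
    qed
    then show ?thesis using cover by (simp add: maximal_points_def supp Bex_def)
  qed
  from this[of "x + g" 1] this[of "x - g" "-1"] show ?thesis
    using that by (simp add: coord_add coord_diff cg)
qed

lemma Sigma_set_subset_convex_hull: "Sigma_set \<subseteq> convex hull maximal_points"
proof
  fix x assume "x \<in> Sigma_set"
  then obtain g where g: "x + g \<in> maximal_points" "x - g \<in> maximal_points"
    by (rule extend_to_maximal)
  have "(1/2) *\<^sub>R (x + g) + (1/2) *\<^sub>R (x - g) \<in> convex hull maximal_points"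
    using g by (intro convexD[OF convex_convex_hull] hull_inc) auto
  moreover have "(1/2) *\<^sub>R (x + g) + (1/2) *\<^sub>R (x - g) = x"
    by (rule tree_space_eqI) (simp add: coord_add coord_diff coord_scaleR field_simps)
  ultimately show "x \<in> convex hull maximal_points" by simp
qed

text \<open>A choice from singletons is unique, so the determining property reduces to one closed
  convex hull.\<close>

lemma SCD_set_of_countable_singleton_slices:
  fixes A :: "'a::real_normed_vector set"
  assumes "bounded A" "A \<noteq> {}" "countable C" "\<And>x. x \<in> C \<Longrightarrow> slice_of A {x}"
    and "A \<subseteq> closure (convex hull C)"
  shows "SCD_set A"
proof -
  let ?I = "to_nat_on C ` C" and ?S = "\<lambda>n. {from_nat_into C n}"
  have from_to: "from_nat_into C (to_nat_on C x) = x" if "x \<in> C" for x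
    using assms(3) that by (rule from_nat_into_to_nat_on)
  have slices: "slice_of A (?S n)" if "n \<in> ?I" for n
    using that assms(4) from_to by auto
  moreover have "A \<subseteq> closure (convex hull (x ` ?I))" if "\<forall>n\<in>?I. x n \<in> ?S n" for x
  proof -
    have "x ` ?I = C" using that from_to by (force simp: image_image)
    then show ?thesis using assms(5) by simp
  qed
  moreover have "?S n \<subseteq> A" if "n \<in> ?I" for n
    using slices[OF that] unfolding slice_of_def by blast
  ultimately have "determining_for ?I ?S A"
    unfolding determining_for_def by blast
  then show ?thesis
    unfolding SCD_set_def using assms(1,2) slices
    by (intro conjI exI[of _ ?I] exI[of _ ?S] ballI)
qed

lemma zero_in_Sigma_set: "0 \<in> Sigma_set"
  by (rule Sigma_setI) (simp_all add: coord_zero)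

lemma SCD_Sigma_set: "SCD_set Sigma_set"
proof (rule SCD_set_of_countable_singleton_slices)
  show "bounded Sigma_set"
    unfolding Sigma_set_def by (rule bounded_subset[OF bounded_cball]) blast
  show "Sigma_set \<noteq> {}" using zero_in_Sigma_set by blast
  show "countable maximal_points"
    by (rule countable_subset[OF _ countable_Sigma_set]) (auto simp: maximal_points_def)
  show "Sigma_set \<subseteq> closure (convex hull maximal_points)"
    using Sigma_set_subset_convex_hull closure_subset by blast
qed (rule maximal_point_slice)

section \<open>Weak neighbourhoods\<close>

lemma weak_nbhd_basic:
  fixes U :: "'a::real_normed_vector set"
  assumes "openin weak_topology U" "x \<in> U"
  obtains \<F> and \<epsilon> :: real where "finite \<F>" "\<forall>f\<in>\<F>. bounded_linear f" "\<epsilon> > 0"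
    "{y. \<forall>f\<in>\<F>. \<bar>f y - f x\<bar> < \<epsilon>} \<subseteq> U"
proof -
  have "\<exists>\<F> (\<epsilon>::real). finite \<F> \<and> (\<forall>f\<in>\<F>. bounded_linear f) \<and> \<epsilon> > 0 \<and>
      {y. \<forall>f\<in>\<F>. \<bar>f y - f x\<bar> < \<epsilon>} \<subseteq> U"
    using assms unfolding weak_topology_def openin_topology_generated_by_iff
  proof (induction rule: generate_topology_on.induct)
    case Empty
    then show ?case by simp
  next
    case (Int a b)
    then have "x \<in> a" "x \<in> b" by auto
    from Int.IH(1)[OF \<open>x \<in> a\<close>] obtain \<F> and \<epsilon> :: real where a:
      "finite \<F>" "\<forall>f\<in>\<F>. bounded_linear f" "\<epsilon> > 0" "{y. \<forall>f\<in>\<F>. \<bar>f y - f x\<bar> < \<epsilon>} \<subseteq> a"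
      by blast
    from Int.IH(2)[OF \<open>x \<in> b\<close>] obtain \<G> and \<delta> :: real where b:
      "finite \<G>" "\<forall>f\<in>\<G>. bounded_linear f" "\<delta> > 0" "{y. \<forall>f\<in>\<G>. \<bar>f y - f x\<bar> < \<delta>} \<subseteq> b"
      by blast
    have "{y. \<forall>f\<in>\<F> \<union> \<G>. \<bar>f y - f x\<bar> < min \<epsilon> \<delta>} \<subseteq> a \<inter> b"
      using a(4) b(4) by auto
    with a b show ?case
      by (intro exI[of _ "\<F> \<union> \<G>"] exI[of _ "min \<epsilon> \<delta>"]) auto
  next
    case (UN K)
    then obtain k where k: "k \<in> K" "x \<in> k" by blast
    from UN.IH[OF this] obtain \<F> and \<epsilon> :: real where "finite \<F>" "\<forall>f\<in>\<F>. bounded_linear f" "\<epsilon> > 0"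
      "{y. \<forall>f\<in>\<F>. \<bar>f y - f x\<bar> < \<epsilon>} \<subseteq> k" by blast
    with k(1) show ?case by (meson Union_upper order_trans)
  next
    case (Basis s)
    then obtain f :: "'a \<Rightarrow> real" and V
      where f: "s = f -` V" "bounded_linear f" "open V" by blast
    then obtain \<epsilon> where "\<epsilon> > 0" "\<forall>r. dist r (f x) < \<epsilon> \<longrightarrow> r \<in> V"
      using Basis.prems unfolding open_dist by blast
    then show ?case
      using f by (intro exI[of _ "{f}"] exI[of _ \<epsilon>]) (auto simp: dist_real_def)
  qed
  then show ?thesis using that by blast
qed

definition unit_vec :: "bool list \<Rightarrow> tree_space" where
  "unit_vec t = Abs_tree_space (\<lambda>s. if s = t then 1 else 0)"

lemma coord_unit_vec: "coord (unit_vec t) s = (if s = t then 1 else 0)"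
  unfolding unit_vec_def by (subst coord_Abs_finite_support) auto

lemma coord_sum: "coord (sum g S) t = (\<Sum>i\<in>S. coord (g i) t)"
  by (induction S rule: infinite_finite_induct) (auto simp: coord_zero coord_add)

text \<open>Evaluate \<open>f\<close> at the signed sum of the unit vectors with the signs of \<open>f(e\<^sub>t)\<close>: over an
  antichain this is a point of \<open>\<Sigma>\<close>, so its norm is at most \<open>1\<close> however large \<open>A\<close> is.\<close>

lemma sum_functional_antichain_le:
  assumes f: "bounded_linear f" and A: "finite A"
    and anti: "\<And>s t. s \<in> A \<Longrightarrow> t \<in> A \<Longrightarrow> s \<noteq> t \<Longrightarrow> s \<parallel> t"
  shows "(\<Sum>t\<in>A. \<bar>f (unit_vec t)\<bar>) \<le> onorm f"
proof -
  interpret f: bounded_linear f by (fact f)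
  define z where "z = (\<Sum>t\<in>A. sgn (f (unit_vec t)) *\<^sub>R unit_vec t)"
  have cz: "coord z s = (if s \<in> A then sgn (f (unit_vec s)) else 0)" for s
    using A by (simp add: z_def coord_sum coord_scaleR coord_unit_vec sum.delta' if_distrib cong: if_cong)
  have "z \<in> Sigma_set"
  proof (rule Sigma_setI)
    show "finite {s. coord z s \<noteq> 0}"
      by (rule finite_subset[OF _ A]) (auto simp: cz)
    show "coord z s \<in> {-1, 0, 1}" for s by (simp add: cz sgn_if)
    show "s \<parallel> t" if "coord z s \<noteq> 0" "coord z t \<noteq> 0" "s \<noteq> t" for s t
      using that by (intro anti) (simp_all add: cz split: if_splits)
  qed
  then have "norm z \<le> 1" by (simp add: Sigma_set_def)
  have "(\<Sum>t\<in>A. \<bar>f (unit_vec t)\<bar>) = f z"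
    by (simp add: z_def f.sum f.scaleR abs_sgn mult.commute)
  also have "\<dots> \<le> norm (f z)" by simp
  also have "\<dots> \<le> onorm f * norm z" by (rule onorm[OF f])
  also have "\<dots> \<le> onorm f"
    using \<open>norm z \<le> 1\<close> onorm_pos_le[OF f] by (rule mult_left_le)
  finally show ?thesis .
qed

section \<open>Branches\<close>

text \<open>A branch of the tree is encoded by the infinite \<open>0\<close>-\<open>1\<close> sequence \<open>b\<close> whose initial
  segments are its nodes.\<close>

definition node :: "(nat \<Rightarrow> bool) \<Rightarrow> nat \<Rightarrow> bool list" where
  "node b n = map b [0..<n]"

lemma length_node [simp]: "length (node b n) = n"
  by (simp add: node_def)

lemma prefix_node: "m \<le> n \<Longrightarrow> prefix (node b m) (node b n)"
  using take_is_prefix[of m "node b n"] by (simp add: node_def take_map)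

lemma nodes_not_parallel: "\<not> node b m \<parallel> node b n"
  using prefix_node[of m n b] prefix_node[of n m b] nat_le_linear[of m n]
  by (auto simp: parallel_def)

lemma range_node_chain: "range (node b) \<in> tree_chains"
  using nodes_not_parallel[of b]
  by (auto simp: tree_chains_def Complete_Partial_Order.chain_def parallel_def)

definition branch_sum :: "(nat \<Rightarrow> bool) \<Rightarrow> tree_space \<Rightarrow> real" where
  "branch_sum b x = (\<Sum>\<^sub>\<infinity>t\<in>range (node b). coord x t)"

text \<open>The nodes of a branch form a chain, so the norm of \<open>X\<close> dominates the absolute
  coordinate sum along the branch.\<close>

lemma bounded_linear_branch_sum: "bounded_linear (branch_sum b)"
proof -
  have abs: "(\<lambda>t. norm (coord x t)) summable_on range (node b)" for x
    using coord_summable_on[OF range_node_chain] by simp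
  have summ: "(\<lambda>t. coord x t) summable_on range (node b)" for x
    using abs by (rule abs_summable_summable)
  show ?thesis
  proof (rule bounded_linear_intro[where K = 1])
    show "branch_sum b (x + y) = branch_sum b x + branch_sum b y" for x y
      unfolding branch_sum_def coord_add by (rule infsum_add[OF summ summ])
    show "branch_sum b (r *\<^sub>R x) = r *\<^sub>R branch_sum b x" for r x
      unfolding branch_sum_def coord_scaleR by (simp add: infsum_cmult_right summ)
    show "norm (branch_sum b x) \<le> norm x * 1" for x
    proof -
      have "norm (branch_sum b x) \<le> (\<Sum>\<^sub>\<infinity>t\<in>range (node b). norm (coord x t))"
        unfolding branch_sum_def by (rule norm_infsum_bound[OF abs])
      also have "\<dots> \<le> norm x"
        unfolding norm_eq[of x] real_norm_def
        by (rule cSUP_upper[OF range_node_chain norm_bdd_above])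
      finally show ?thesis by simp
    qed
  qed
qed

lemma branch_sum_single:
  assumes "x \<in> Sigma_set" "coord x (node b n) \<noteq> 0"
  shows "branch_sum b x = coord x (node b n)"
proof -
  have "coord x t = 0" if "t \<in> range (node b)" "t \<noteq> node b n" for t
  proof -
    have "\<not> t \<parallel> node b n"
      using that(1) nodes_not_parallel by blast
    then show ?thesis using Sigma_set_parallel[OF assms(1) _ assms(2)] that(2) by blast
  qed
  then have "branch_sum b x = (\<Sum>\<^sub>\<infinity>t\<in>{node b n}. coord x t)"
    unfolding branch_sum_def by (intro infsum_cong_neutral) auto
  then show ?thesis by simp
qed

lemma branch_sum_unit_vec: "branch_sum b (unit_vec (node b n)) = 1"
proof -
  have "unit_vec (node b n) \<in> Sigma_set"
    by (rule Sigma_setI) (auto simp: coord_unit_vec split: if_splits)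
  then show ?thesis using branch_sum_single[of _ b n] by (simp add: coord_unit_vec)
qed

lemma eventually_nodes_distinct:
  assumes "finite B"
  shows "\<forall>\<^sub>F n in sequentially. inj_on (\<lambda>b. node b n) B"
proof -
  have "\<forall>\<^sub>F n in sequentially. b \<noteq> c \<longrightarrow> node b n \<noteq> node c n" for b c
  proof (cases "b = c")
    case False
    then obtain k where k: "b k \<noteq> c k" by blast
    have "node b n \<noteq> node c n" if "n > k" for n
      using k that by (auto simp: node_def)
    then show ?thesis
      by (intro eventually_mono[OF eventually_gt_at_top[of k]]) blast
  qed simp
  then have "\<forall>\<^sub>F n in sequentially. \<forall>b\<in>B. \<forall>c\<in>B. b \<noteq> c \<longrightarrow> node b n \<noteq> node c n"
    using assms by (intro eventually_ball_finite ballI)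
  then show ?thesis
    by (rule eventually_mono) (auto simp: inj_on_def)
qed

lemma uncountable_branches: "\<not> countable (UNIV :: (nat \<Rightarrow> bool) set)"
proof
  assume "countable (UNIV :: (nat \<Rightarrow> bool) set)"
  then obtain e :: "nat \<Rightarrow> nat \<Rightarrow> bool" where "range e = UNIV"
    using uncountable_def by blast
  then obtain n where "e n = (\<lambda>k. \<not> e k k)" by (metis surj_def)
  then show False by metis
qed

definition near_zero_on_branch :: "(nat \<Rightarrow> bool) \<Rightarrow> tree_space set" where
  "near_zero_on_branch b = {x \<in> Sigma_set. \<bar>branch_sum b x\<bar> < 1/2}"

lemma openin_near_zero_on_branch:
  "openin (subtopology weak_topology Sigma_set) (near_zero_on_branch b)"
proof -
  have "openin weak_topology (branch_sum b -` {-(1/2)<..<1/2})"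
    unfolding weak_topology_def
    by (intro topology_generated_by_Basis CollectI exI[of _ "branch_sum b"]
        exI[of _ "{-(1/2)<..<1/2 :: real}"] conjI refl
        bounded_linear_branch_sum open_greaterThanLessThan)
  moreover have "near_zero_on_branch b = branch_sum b -` {-(1/2)<..<1/2} \<inter> Sigma_set"
    by (auto simp: near_zero_on_branch_def)
  ultimately show ?thesis unfolding openin_subtopology by blast
qed

text \<open>A point of \<open>\<Sigma>\<close> that meets the branch \<open>b\<close> has branch sum \<open>\<plusminus>1\<close>; so \<open>x\<close> misses \<open>b\<close>
  altogether. A node of \<open>b\<close> longer than everything in the support of \<open>x\<close> is therefore
  incomparable to that support, and adding its unit vector raises the branch sum by \<open>1\<close>.\<close>

lemma add_node_leaves_near_zero_on_branch:
  assumes x: "x \<in> near_zero_on_branch b"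
    and n: "\<And>t. coord x t \<noteq> 0 \<Longrightarrow> length t < n"
  shows "x + unit_vec (node b n) \<in> Sigma_set - near_zero_on_branch b"
proof -
  interpret bounded_linear "branch_sum b" by (rule bounded_linear_branch_sum)
  have xS: "x \<in> Sigma_set" and small: "\<bar>branch_sum b x\<bar> < 1/2"
    using x by (auto simp: near_zero_on_branch_def)
  have off: "coord x (node b m) = 0" for m
    using branch_sum_single[OF xS, of b m] small Sigma_set_coord[OF xS, of "node b m"] by auto
  have par: "t \<parallel> node b n" "node b n \<parallel> t" if t: "coord x t \<noteq> 0" for t
  proof -
    have "\<not> prefix (node b n) t"
      using n[OF t] prefix_length_le by fastforce
    moreover have "\<not> prefix t (node b n)"
    proof
      assume "prefix t (node b n)"
      then have "t = take (length t) (node b n)"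
        by (auto simp: prefix_def)
      also have "\<dots> = node b (length t)"
        using n[OF t] by (simp add: node_def take_map)
      finally show False using off t by metis
    qed
    ultimately show "t \<parallel> node b n" "node b n \<parallel> t" by (auto simp: parallel_def)
  qed
  let ?y = "x + unit_vec (node b n)"
  have cy: "coord ?y t = (if t = node b n then 1 else coord x t)" for t
    using off by (simp add: coord_add coord_unit_vec)
  have "?y \<in> Sigma_set"
  proof (rule Sigma_setI)
    have "finite (insert (node b n) {t. coord x t \<noteq> 0})"
      using Sigma_set_finite[OF xS] by simp
    then show "finite {t. coord ?y t \<noteq> 0}"
      by (rule rev_finite_subset) (auto simp: cy)
    show "coord ?y t \<in> {-1, 0, 1}" for t
      using Sigma_set_coord[OF xS, of t] by (simp add: cy)
    show "s \<parallel> t" if "coord ?y s \<noteq> 0" "coord ?y t \<noteq> 0" "s \<noteq> t" for s t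
      using that Sigma_set_parallel[OF xS, of s t] par by (simp add: cy split: if_splits)
  qed
  moreover have "branch_sum b ?y = branch_sum b x + 1"
    by (simp add: add branch_sum_unit_vec)
  ultimately show ?thesis using small by (auto simp: near_zero_on_branch_def)
qed

text \<open>With \<open>V\<close> containing a neighbourhood of \<open>x\<close> given by \<open>\<F>\<close> and \<open>\<epsilon>\<close>, every such branch
  carries at each high level a node \<open>s\<close> with \<open>|f(e\<^sub>s)| \<ge> \<epsilon>\<close> for some \<open>f \<in> \<F>\<close>. Summing over
  finitely many branches at a level that separates them bounds their number by
  \<open>(\<Sum>f\<in>\<F>. \<parallel>f\<parallel>) / \<epsilon>\<close>.\<close>

lemma finite_branches_with_open_subset:
  assumes V: "openin (subtopology weak_topology Sigma_set) V" "V \<noteq> {}"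
  shows "finite {b. V \<subseteq> near_zero_on_branch b}"
proof -
  obtain U where U: "openin weak_topology U" "V = U \<inter> Sigma_set"
    using V(1) unfolding openin_subtopology by blast
  obtain x where x: "x \<in> V" using V(2) by blast
  then have "x \<in> U" using U(2) by blast
  with U(1) obtain \<F> and \<epsilon> :: real where \<F>: "finite \<F>" "\<forall>f\<in>\<F>. bounded_linear f" "\<epsilon> > 0"
    "{y. \<forall>f\<in>\<F>. \<bar>f y - f x\<bar> < \<epsilon>} \<subseteq> U"
    by (rule weak_nbhd_basic)
  have xS: "x \<in> Sigma_set" using x U(2) by blast
  then have finx: "finite {t. coord x t \<noteq> 0}" by (rule Sigma_set_finite)
  have "card B \<le> nat \<lfloor>(\<Sum>f\<in>\<F>. onorm f) / \<epsilon>\<rfloor>"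
    if B: "B \<subseteq> {b. V \<subseteq> near_zero_on_branch b}" "finite B" for B
  proof -
    have "\<forall>\<^sub>F n in sequentially. \<forall>t\<in>{t. coord x t \<noteq> 0}. length t < n"
      by (intro eventually_ball_finite finx ballI eventually_gt_at_top)
    then have "\<forall>\<^sub>F n in sequentially. inj_on (\<lambda>b. node b n) B \<and> (\<forall>t. coord x t \<noteq> 0 \<longrightarrow> length t < n)"
      using eventually_nodes_distinct[OF B(2)] by eventually_elim blast
    then obtain n where n: "inj_on (\<lambda>b. node b n) B" "\<And>t. coord x t \<noteq> 0 \<Longrightarrow> length t < n"
      unfolding eventually_sequentially by blast
    have large: "\<epsilon> \<le> (\<Sum>f\<in>\<F>. \<bar>f (unit_vec (node b n))\<bar>)" if "b \<in> B" for b
    proof -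
      have b: "V \<subseteq> near_zero_on_branch b" using B(1) that by blast
      then have "x + unit_vec (node b n) \<in> Sigma_set - near_zero_on_branch b"
        using add_node_leaves_near_zero_on_branch[of x b n] x n(2) by blast
      then have "x + unit_vec (node b n) \<notin> U" using b U(2) by blast
      then obtain f where f: "f \<in> \<F>" "\<not> \<bar>f (x + unit_vec (node b n)) - f x\<bar> < \<epsilon>"
        using \<F>(4) by blast
      interpret bounded_linear f using \<F>(2) f(1) by blast
      have "\<epsilon> \<le> \<bar>f (unit_vec (node b n))\<bar>" using f(2) by (simp add: add)
      also have "\<dots> \<le> (\<Sum>f\<in>\<F>. \<bar>f (unit_vec (node b n))\<bar>)"
        using \<F>(1) f(1) by (intro member_le_sum) auto
      finally show ?thesis .
    qed
    have "card B * \<epsilon> \<le> (\<Sum>b\<in>B. \<Sum>f\<in>\<F>. \<bar>f (unit_vec (node b n))\<bar>)"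
      using large by (rule sum_bounded_below)
    also have "\<dots> = (\<Sum>f\<in>\<F>. \<Sum>b\<in>B. \<bar>f (unit_vec (node b n))\<bar>)"
      by (rule sum.swap)
    also have "\<dots> = (\<Sum>f\<in>\<F>. \<Sum>t\<in>(\<lambda>b. node b n) ` B. \<bar>f (unit_vec t)\<bar>)"
      by (simp add: sum.reindex[OF n(1)])
    also have "\<dots> \<le> (\<Sum>f\<in>\<F>. onorm f)"
    proof (rule sum_mono, rule sum_functional_antichain_le)
      show "s \<parallel> t" if "s \<in> (\<lambda>b. node b n) ` B" "t \<in> (\<lambda>b. node b n) ` B" "s \<noteq> t" for s t
        using that by (intro parallel_of_same_length) auto
    qed (use \<F>(2) B(2) in auto)
    finally have "card B \<le> (\<Sum>f\<in>\<F>. onorm f) / \<epsilon>"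
      using \<F>(3) by (simp add: field_simps)
    then show ?thesis by linarith
  qed
  then show ?thesis by (rule finite_if_finite_subsets_card_bdd[THEN conjunct1])
qed

theorem proposition3p7:
  shows "SCD_set Sigma_set \<and>
    \<not> has_countable_pi_base (subtopology weak_topology Sigma_set)"
proof
  show "SCD_set Sigma_set" by (rule SCD_Sigma_set)
  show "\<not> has_countable_pi_base (subtopology weak_topology Sigma_set)"
  proof
    assume "has_countable_pi_base (subtopology weak_topology Sigma_set)"
    then obtain I :: "nat set" and V
      where pi: "pi_base (subtopology weak_topology Sigma_set) I V"
      unfolding has_countable_pi_base_def by blast
    have "countable (\<Union>i\<in>I. {b. V i \<subseteq> near_zero_on_branch b})"
      using pi unfolding pi_base_def
      by (intro countable_UN[OF countableI_type] countable_finite finite_branches_with_open_subset) auto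
    moreover have "\<exists>i\<in>I. V i \<subseteq> near_zero_on_branch b" for b
    proof -
      interpret bounded_linear "branch_sum b" by (rule bounded_linear_branch_sum)
      have "0 \<in> near_zero_on_branch b"
        by (simp add: near_zero_on_branch_def zero_in_Sigma_set zero)
      then show ?thesis
        using pi openin_near_zero_on_branch unfolding pi_base_def by blast
    qed
    then have "(\<Union>i\<in>I. {b. V i \<subseteq> near_zero_on_branch b}) = UNIV" by blast
    ultimately show False using uncountable_branches by metis
  qed
qed

end
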